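(* The value of $\dim^k(G)-\dim_f^k(G)$ can be arbitrarily large, as $G$ varies, for some $k\in\{1,2,\ldots,\kappa(G)\}$. That is, for every real number $N$ there exist a connected graph $G$ and an integer $k\in\{1,2,\ldots,\kappa(G)\}$ such that $\dim^k(G)-\dim_f^k(G)>N$.
   Context: All graphs are finite, simple, undirected and connected, with at least two vertices. $d(x,y)$ is the length of a shortest path between $x$ and $y$ in $G$. For distinct $x,y\in V(G)$, let $R\{x,y\}=\{z\in V(G): d(x,z)\neq d(y,z)\}$, and let $\kappa(G)=\min\{|R\{x,y\}|: x\neq y,\ x,y\in V(G)\}$. For an integer $k\in\{1,2,\ldots,\kappa(G)\}$, a set $S\subseteq V(G)$ is a $k$-resolving set of $G$ if $|S\cap R\{x,y\}|\ge k$ for any two distinct vertices $x,y$ of $G$; the $k$-metric dimension $\dim^k(G)$ is the minimum cardinality of a $k$-resolving set of $G$. For a function $g$ on $V(G)$ and $U\subseteq V(G)$, write $g(U)=\sum_{s\in U}g(s)$. For a real number $k\in[1,\kappa(G)]$, a function $g:V(G)\to[0,1]$ is a $k$-resolving function of $G$ if $g(R\{x,y\})\ge k$ for any two distinct vertices $x,y\in V(G)$; the fractional $k$-metric dimension is $\dim_f^k(G)=\min\{g(V(G)): g \text{ is a } k\text{-resolving function of } G\}$. *)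

theory Defs
  imports "HOL-Analysis.Analysis" "Graph_Theory.Graph_Theory"
begin

text \<open>
  An undirected simple graph is a symmetric loop-free digraph whose arcs are vertex pairs
  (\<^locale>\<open>pair_graph\<close>; finiteness is part of that locale). The name \<open>connected\<close> is qualified
  because the topological notion has the same short name.
\<close>

definition conn_graph :: "'a pair_pre_digraph \<Rightarrow> bool" where
  "conn_graph G \<longleftrightarrow>
     pair_graph G \<and> Digraph_Component.connected (with_proj G) \<and> card (pverts G) \<ge> 2"

definition gdist :: "'a pair_pre_digraph \<Rightarrow> 'a \<Rightarrow> 'a \<Rightarrow> nat" where
  "gdist G x y = (LEAST n. \<exists>p. pre_digraph.apath (with_proj G) x p y \<and> length p = n)"

definition resolvers :: "'a pair_pre_digraph \<Rightarrow> 'a \<Rightarrow> 'a \<Rightarrow> 'a set" where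
  "resolvers G x y = {z \<in> pverts G. gdist G x z \<noteq> gdist G y z}"

definition kappa :: "'a pair_pre_digraph \<Rightarrow> nat" where
  "kappa G = Min {card (resolvers G x y) | x y. x \<in> pverts G \<and> y \<in> pverts G \<and> x \<noteq> y}"

definition k_resolving_set :: "'a pair_pre_digraph \<Rightarrow> nat \<Rightarrow> 'a set \<Rightarrow> bool" where
  "k_resolving_set G k S \<longleftrightarrow> S \<subseteq> pverts G \<and>
     (\<forall>x \<in> pverts G. \<forall>y \<in> pverts G. x \<noteq> y \<longrightarrow> card (S \<inter> resolvers G x y) \<ge> k)"

text \<open>
  The two dimensions below are meaningful only for \<open>1 \<le> k \<le> kappa G\<close>. That restriction is
  not part of the definitions and has to be imposed where they are used.
\<close>

definition kdim :: "'a pair_pre_digraph \<Rightarrow> nat \<Rightarrow> nat" where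
  "kdim G k = Min {card S | S. k_resolving_set G k S}"

text \<open>
  A function on the vertex set is a total function whose values off \<open>pverts G\<close> are ignored.
\<close>

definition k_resolving_fun :: "'a pair_pre_digraph \<Rightarrow> real \<Rightarrow> ('a \<Rightarrow> real) \<Rightarrow> bool" where
  "k_resolving_fun G k g \<longleftrightarrow> (\<forall>v \<in> pverts G. 0 \<le> g v \<and> g v \<le> 1) \<and>
     (\<forall>x \<in> pverts G. \<forall>y \<in> pverts G. x \<noteq> y \<longrightarrow> sum g (resolvers G x y) \<ge> k)"

text \<open>
  The infimum is a minimum in the admissible range of \<open>k\<close>; see \<open>frac_kdim_attained\<close>.
\<close>

definition frac_kdim :: "'a pair_pre_digraph \<Rightarrow> real \<Rightarrow> real" where
  "frac_kdim G k = Inf {sum g (pverts G) | g. k_resolving_fun G k g}"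

lemma conn_graph_finite: "conn_graph G \<Longrightarrow> finite (pverts G)"
  unfolding conn_graph_def
  by (meson pair_fin_digraph.pair_finite_verts pair_graph_def pair_pseudo_graph_def)

lemma kappa_le:
  assumes "finite (pverts G)" "x \<in> pverts G" "y \<in> pverts G" "x \<noteq> y"
  shows "kappa G \<le> card (resolvers G x y)"
proof -
  let ?A = "{card (resolvers G x y) | x y. x \<in> pverts G \<and> y \<in> pverts G \<and> x \<noteq> y}"
  have "?A \<subseteq> (\<lambda>(x,y). card (resolvers G x y)) ` (pverts G \<times> pverts G)" by auto
  then have "finite ?A" by (rule finite_subset) (use assms in simp)
  then show ?thesis unfolding kappa_def by (rule Min_le) (use assms in blast)
qed

lemma kdim_attained:
  assumes G: "conn_graph G" and k: "k \<le> kappa G"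
  shows "\<exists>S. k_resolving_set G k S \<and> card S = kdim G k \<and>
             (\<forall>T. k_resolving_set G k T \<longrightarrow> card S \<le> card T)"
proof -
  note fin = conn_graph_finite[OF G]
  let ?A = "{card S | S. k_resolving_set G k S}"
  have "?A \<subseteq> card ` Pow (pverts G)" by (auto simp: k_resolving_set_def)
  then have finA: "finite ?A" by (rule finite_subset) (use fin in simp)
  have "k_resolving_set G k (pverts G)"
    unfolding k_resolving_set_def
  proof (intro conjI ballI impI)
    fix x y assume "x \<in> pverts G" "y \<in> pverts G" "x \<noteq> y"
    moreover have "pverts G \<inter> resolvers G x y = resolvers G x y"
      by (auto simp: resolvers_def)
    ultimately show "k \<le> card (pverts G \<inter> resolvers G x y)"
      using kappa_le[OF fin] k by (metis order_trans)
  qed simp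
  then have "?A \<noteq> {}" by blast
  then have "kdim G k \<in> ?A" unfolding kdim_def using finA by (rule Min_in[rotated])
  then show ?thesis using Min_le[OF finA] unfolding kdim_def by force
qed

lemma frac_kdim_attained:
  assumes G: "conn_graph G" and k: "k \<le> real (kappa G)"
  shows "\<exists>g. k_resolving_fun G k g \<and> sum g (pverts G) = frac_kdim G k \<and>
             (\<forall>h. k_resolving_fun G k h \<longrightarrow> sum g (pverts G) \<le> sum h (pverts G))"
proof -
  note fin = conn_graph_finite[OF G]
  let ?V = "pverts G"
  define B where "B = PiE UNIV (\<lambda>v. if v \<in> ?V then {0..1::real} else {0})"
  define K where "K = B \<inter> (\<Inter>x\<in>?V. \<Inter>y\<in>?V - {x}. {g. k \<le> sum g (resolvers G x y)})"
  have "compactin (product_topology (\<lambda>_. euclidean) UNIV) B"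
    unfolding B_def compactin_PiE by simp
  then have "compact B" by (simp add: euclidean_product_topology)
  have cont: "continuous_on UNIV (\<lambda>g::'a \<Rightarrow> real. sum g A)" for A
    by (intro continuous_on_sum continuous_on_product_coordinates)
  have "closed (\<Inter>x\<in>?V. \<Inter>y\<in>?V - {x}. {g. k \<le> sum g (resolvers G x y)})"
    by (intro closed_INT ballI closed_Collect_le cont continuous_on_const)
  with \<open>compact B\<close> have "compact K" unfolding K_def by (rule compact_Int_closed)
  have K_res: "k_resolving_fun G k g" if "g \<in> K" for g
  proof -
    have "g v \<in> (if v \<in> ?V then {0..1} else {0})" for v
      using that unfolding K_def B_def by (auto simp: PiE_def Pi_def)
    then have "0 \<le> g v \<and> g v \<le> 1" if "v \<in> ?V" for v
      using that by (metis atLeastAtMost_iff)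
    then show ?thesis using that unfolding K_def k_resolving_fun_def by auto
  qed
  have res_K: "\<exists>g\<in>K. sum g ?V = sum h ?V" if h: "k_resolving_fun G k h" for h
  proof
    let ?g = "\<lambda>v. if v \<in> ?V then h v else 0"
    have "sum ?g (resolvers G x y) = sum h (resolvers G x y)" for x y
      by (rule sum.cong) (auto simp: resolvers_def)
    then show "?g \<in> K" using h unfolding K_def B_def k_resolving_fun_def by auto
    show "sum ?g ?V = sum h ?V" by (rule sum.cong) auto
  qed
  have "k_resolving_fun G k (\<lambda>_. 1)"
    unfolding k_resolving_fun_def
  proof (intro conjI ballI impI)
    fix x y assume "x \<in> ?V" "y \<in> ?V" "x \<noteq> y"
    then have "real (kappa G) \<le> real (card (resolvers G x y))" using kappa_le[OF fin] by simp
    with k show "k \<le> (\<Sum>_\<in>resolvers G x y. 1)" by simp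
  qed simp_all
  then have "K \<noteq> {}" using res_K by blast
  then obtain g where g: "g \<in> K" "\<And>h. h \<in> K \<Longrightarrow> sum g ?V \<le> sum h ?V"
    using continuous_attains_inf[OF \<open>compact K\<close> _ continuous_on_subset[OF cont[of ?V]]] by auto
  have le: "sum g ?V \<le> sum h ?V" if "k_resolving_fun G k h" for h
    using res_K[OF that] g(2) by force
  have "frac_kdim G k = sum g ?V"
    unfolding frac_kdim_def by (rule cInf_eq_minimum) (use K_res[OF g(1)] le in blast)+
  then show ?thesis using K_res[OF g(1)] le by auto
qed

end

theory Submission
  imports Defs
begin

text \<open>
  Complete graphs witness the gap, at \<open>k = 1\<close>. Two distinct vertices of \<open>K\<^sub>n\<close> are resolved only by
  themselves, so a resolving set misses at most one vertex and the metric dimension is at least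
  \<open>n - 1\<close>, whereas the constant function \<open>1/2\<close> is resolving with total weight \<open>n/2\<close>.
\<close>

lemma gdist_self:
  assumes "x \<in> pverts G"
  shows "gdist G x x = 0"
proof -
  have "pre_digraph.apath (with_proj G) x [] x"
    using assms by (simp add: pre_digraph.apath_def pre_digraph.awalk_def pre_digraph.cas.simps
        pre_digraph.awalk_verts.simps)
  then show ?thesis
    unfolding gdist_def by (intro Least_eq_0) auto
qed

lemma gdist_adjacent:
  assumes G: "pair_graph G" and xy: "(x, y) \<in> parcs G"
  shows "gdist G x y = 1"
proof -
  interpret pair_graph G by (rule G)
  have ne: "x \<noteq> y" using pair_no_loops[OF xy] by simp
  show ?thesis unfolding gdist_def
  proof (rule Least_equality)
    have "apath x [(x, y)] y"
      using xy ne by (auto simp: apath_Cons_iff apath_Nil_iff in_arcsD2)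
    then show "\<exists>p. apath x p y \<and> length p = 1" by force
  next
    fix m assume "\<exists>p. apath x p y \<and> length p = m"
    \<comment> \<open>Length 0 would mean the empty path, which only joins a vertex to
      itself.\<close>
    then show "1 \<le> m" using ne by (cases m) (auto simp: apath_Nil_iff)
  qed
qed

text \<open>Distinct vertices are at distance 1, so a third vertex sees \<open>x\<close> and
  \<open>y\<close> alike, while each of these two is at distance 0 from itself and 1 from the
  other.\<close>

lemma resolvers_complete:
  assumes K: "K\<^bsub>n\<^esub> (with_proj G)" and xy: "x \<in> pverts G" "y \<in> pverts G" "x \<noteq> y"
  shows "resolvers G x y = {x, y}"
proof -
  have "gdist G u v = (if u = v then 0 else 1)" if "u \<in> pverts G" "v \<in> pverts G" for u v
    using that K gdist_self[of u G] gdist_adjacent[OF pair_graphI_complete[OF K], of u v]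
    by (cases "u = v") (simp_all add: complete_digraph_pair_def)
  then show ?thesis using xy by (auto simp: resolvers_def split: if_splits)
qed

lemma conn_graph_complete:
  assumes K: "K\<^bsub>n\<^esub> (with_proj G)" and n: "2 \<le> n"
  shows "conn_graph G"
proof -
  interpret pair_graph G by (rule pair_graphI_complete[OF K])
  have "Digraph_Component.connected (with_proj G)"
  proof (rule connectedI)
    show "pverts G \<noteq> {}"
      using K n by (auto simp: complete_digraph_pair_def)
    fix u v assume "u \<in> pverts G" "v \<in> pverts G"
    then have "u \<rightarrow>\<^sup>*\<^bsub>with_proj G\<^esub> v"
      using K by (cases "u = v") (auto simp: complete_digraph_pair_def)
    then show "u \<rightarrow>\<^sup>*\<^bsub>with_proj (mk_symmetric (with_proj G))\<^esub> v"
      by (rule reachable_mk_symmetricI)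
  qed
  then show ?thesis
    using K n pair_graphI_complete[OF K] by (simp add: conn_graph_def complete_digraph_pair_def)
qed

text \<open>Makes \<open>k = 1\<close> admissible, so that both minima are attained.\<close>

lemma kappa_complete:
  assumes K: "K\<^bsub>n\<^esub> (with_proj G)" and n: "2 \<le> n"
  shows "kappa G = 2"
proof -
  \<comment> \<open>A pair of distinct vertices must exist, or the minimum defining
    \<open>kappa\<close> would range over the empty set.\<close>
  have "\<not> card (pverts G) \<le> Suc 0" "finite (pverts G)"
    using K n by (auto simp: complete_digraph_pair_def)
  then obtain a b where "a \<in> pverts G" "b \<in> pverts G" "a \<noteq> b"
    by (auto simp: card_le_Suc0_iff_eq)
  moreover have "card (resolvers G x y) = 2"
    if "x \<in> pverts G" "y \<in> pverts G" "x \<noteq> y" for x y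
    using resolvers_complete[OF K that] that by simp
  ultimately have
    "{card (resolvers G x y) | x y. x \<in> pverts G \<and> y \<in> pverts G \<and> x \<noteq> y} = {2}"
    by (auto, metis)
  then show ?thesis by (simp add: kappa_def)
qed

lemma kdim_complete_ge:
  assumes K: "K\<^bsub>n\<^esub> (with_proj G)" and n: "2 \<le> n"
  shows "n - 1 \<le> kdim G 1"
proof -
  obtain S where S: "k_resolving_set G 1 S" and card_S: "card S = kdim G 1"
    using kdim_attained[OF conn_graph_complete[OF K n], of 1] kappa_complete[OF K n] by auto
  have fin: "finite (pverts G)" and n_eq: "card (pverts G) = n"
    using K by (auto simp: complete_digraph_pair_def)
  have sub: "S \<subseteq> pverts G" using S by (simp add: k_resolving_set_def)
  \<comment> \<open>Two vertices outside \<open>S\<close> would form a pair with no resolver in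
    \<open>S\<close>, since only the pair resolves itself.\<close>
  have "x = y" if "x \<in> pverts G - S" "y \<in> pverts G - S" for x y
  proof (rule ccontr)
    assume "x \<noteq> y"
    then have "1 \<le> card (S \<inter> {x, y})"
      using S that resolvers_complete[OF K, of x y] by (force simp: k_resolving_set_def)
    moreover have "S \<inter> {x, y} = {}" using that by auto
    ultimately show False by simp
  qed
  then have "card (pverts G - S) \<le> 1"
    using fin by (simp add: card_le_Suc0_iff_eq)
  moreover have "card (pverts G - S) = n - card S"
    using sub fin n_eq by (simp add: card_Diff_subset finite_subset)
  ultimately show ?thesis using card_S by linarith
qed

lemma frac_kdim_complete_le:
  assumes K: "K\<^bsub>n\<^esub> (with_proj G)" and n: "2 \<le> n"
  shows "frac_kdim G 1 \<le> n / 2"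
proof -
  \<comment> \<open>Each resolver set has exactly two elements, so its weight is 1/2 + 1/2 =
    1.\<close>
  have "k_resolving_fun G 1 (\<lambda>_. 1 / 2)"
    using resolvers_complete[OF K] by (auto simp: k_resolving_fun_def)
  then have "frac_kdim G 1 \<le> (\<Sum>_\<in>pverts G. 1 / 2)"
    using frac_kdim_attained[OF conn_graph_complete[OF K n], of 1] kappa_complete[OF K n] by auto
  then show ?thesis using K by (simp add: complete_digraph_pair_def)
qed

theorem theorem2p4:
  shows "\<forall>N :: real. \<exists>G :: nat pair_pre_digraph. \<exists>k :: nat.
           conn_graph G \<and> k \<in> {1..kappa G} \<and> real (kdim G k) - frac_kdim G (real k) > N"
proof
  fix N :: real
  \<comment> \<open>The two bounds give a gap of at least (n - 1) - n/2 = n/2 - 1, which exceeds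
    \<open>N\<close> once n > 2N + 2; the 2 in \<open>max\<close> keeps \<open>n\<close> large
    enough for the lemmas when \<open>N\<close> is small or negative.\<close>
  obtain n :: nat where n: "max 2 (2 * N + 2) < n"
    using reals_Archimedean2 by blast
  define G :: "nat pair_pre_digraph"
    where "G = \<lparr>pverts = {..<n}, parcs = {(u, v). (u, v) \<in> {..<n} \<times> {..<n} \<and> u \<noteq> v}\<rparr>"
  have K: "K\<^bsub>n\<^esub> (with_proj G)" by (simp add: complete_digraph_pair_def G_def)
  have n2: "2 \<le> n" using n by simp
  \<comment> \<open>The subtraction in \<open>kdim_complete_ge\<close> is truncated;
    \<open>n2\<close> allows passing to the reals.\<close>
  have "real n - 1 \<le> kdim G 1" using kdim_complete_ge[OF K n2] n2 by linarith
  then have "real (kdim G 1) - frac_kdim G (real 1) > N"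
    using frac_kdim_complete_le[OF K n2] n by simp
  then show "\<exists>G :: nat pair_pre_digraph. \<exists>k :: nat.
      conn_graph G \<and> k \<in> {1..kappa G} \<and> real (kdim G k) - frac_kdim G (real k) > N"
    using conn_graph_complete[OF K n2] kappa_complete[OF K n2]
    by (intro exI[of _ G] exI[of _ 1]) simp
qed

end
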